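(* Let $\mathcal{X}=\{a_1,\dots,a_n\}$, $\mathcal{Z}=\{b_1,\dots,b_m\}$ be finite and let $\mathcal{Y}=\{c_1,\dots,c_K\}$ be the set of distinct values of $h$. Let $A$ be the $n\times K$ matrix with $A(i,j)=Q(\{z: h(a_i,z)=c_j\})=P(Y_k=c_j\mid X_k=a_i)$, let $T$ be the $n\times n$ transition matrix of the state chain, and let $M=\begin{pmatrix}A & TA & \cdots & T^{n-1}A\end{pmatrix}$, an $n\times nK$ matrix. If $M$ has rank $n$, then the model is $n$ step observable. Furthermore, if $M$ does not have rank $n$, then appending further blocks $T^kA$ with $k\ge n$ to $M$ does not increase its rank.
   Context: Setting: finite state space $\mathcal{X}$, finite noise space $\mathcal{Z}$ with noise law $Q$ (a probability vector), measurement function $h:\mathcal{X}\times\mathcal{Z}\to\mathcal{Y}$. $\{X_k\}$ is a Markov chain with transition matrix $T$, $\{Z_k\}$ i.i.d. with law $Q$ independent of the states, and $Y_k=h(X_k,Z_k)$. For $N\in\mathbb{N}$ let $P(dy_{[1,N]}\mid X_1=x)$ be the conditional law of $(Y_1,\dots,Y_N)$ given $X_1=x$. The model is $N$ step observable if for every function $f:\mathcal{X}\to\mathbb{R}$ and $\epsilon>0$ there is $g:\mathcal{Y}^N\to\mathbb{R}$ with $\max_{x}\left|f(x)-\sum_{y_{[1,N]}}g(y_{[1,N]})P(y_{[1,N]}\mid X_1=x)\right|<\epsilon$. *)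

theory Defs
  imports "HOL-Analysis.Analysis"
begin

(* Hidden Markov model with finite state type 'x, finite noise type 'z,
   transition matrix T (T x x' = P(X_{k+1} = x' | X_k = x)), noise law Q,
   measurement function h, Y_k = h X_k Z_k. *)

definition stochastic_matrix :: "('x::finite \<Rightarrow> 'x \<Rightarrow> real) \<Rightarrow> bool" where
  "stochastic_matrix T \<longleftrightarrow> (\<forall>x x'. 0 \<le> T x x') \<and> (\<forall>x. (\<Sum>x'\<in>UNIV. T x x') = 1)"

definition prob_vector :: "('z::finite \<Rightarrow> real) \<Rightarrow> bool" where
  "prob_vector Q \<longleftrightarrow> (\<forall>z. 0 \<le> Q z) \<and> (\<Sum>z\<in>UNIV. Q z) = 1"

(* The observation space: the set of distinct values of h. *)
definition obs_space :: "('x \<Rightarrow> 'z \<Rightarrow> 'y) \<Rightarrow> 'y set" where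
  "obs_space h = {h x z | x z. True}"

(* Conditional law P(Y_1 = ys!0, ..., Y_N = ys!(N-1) | X_1 = x), N = length ys,
   obtained by summing over all state paths xs (starting at x) and noise
   sequences zs consistent with the observations. *)
definition cond_law ::
  "('x::finite \<Rightarrow> 'x \<Rightarrow> real) \<Rightarrow> ('z::finite \<Rightarrow> real) \<Rightarrow> ('x \<Rightarrow> 'z \<Rightarrow> 'y) \<Rightarrow> 'x \<Rightarrow> 'y list \<Rightarrow> real" where
  "cond_law T Q h x ys =
     (\<Sum>xs | length xs = length ys \<and> (ys \<noteq> [] \<longrightarrow> hd xs = x).
        \<Sum>zs | length zs = length ys \<and> (\<forall>i<length ys. h (xs ! i) (zs ! i) = ys ! i).
          (\<Prod>i<length ys - 1. T (xs ! i) (xs ! Suc i)) * (\<Prod>i<length ys. Q (zs ! i)))"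

(* N step observability *)
definition observable ::
  "('x::finite \<Rightarrow> 'x \<Rightarrow> real) \<Rightarrow> ('z::finite \<Rightarrow> real) \<Rightarrow> ('x \<Rightarrow> 'z \<Rightarrow> 'y) \<Rightarrow> nat \<Rightarrow> bool" where
  "observable T Q h N \<longleftrightarrow>
     (\<forall>f :: 'x \<Rightarrow> real. \<forall>\<epsilon>>0. \<exists>g :: 'y list \<Rightarrow> real.
        \<forall>x. \<bar>f x - (\<Sum>ys | length ys = N \<and> set ys \<subseteq> obs_space h. g ys * cond_law T Q h x ys)\<bar> < \<epsilon>)"

(* Column of the matrix A indexed by observation value y:
   A(x, y) = Q({z. h x z = y}) = P(Y_k = y | X_k = x). *)
definition A_col :: "('z::finite \<Rightarrow> real) \<Rightarrow> ('x::finite \<Rightarrow> 'z \<Rightarrow> 'y) \<Rightarrow> 'y \<Rightarrow> real ^ 'x" where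
  "A_col Q h y = (\<chi> x. \<Sum>z | h x z = y. Q z)"

definition trans_mat :: "('x::finite \<Rightarrow> 'x \<Rightarrow> real) \<Rightarrow> real ^ 'x ^ 'x" where
  "trans_mat T = (\<chi> i j. T i j)"

(* Columns of the block matrix (A  TA  ...  T^(k-1) A), i.e. of T^j A for j < k. *)
definition block_cols ::
  "('x::finite \<Rightarrow> 'x \<Rightarrow> real) \<Rightarrow> ('z::finite \<Rightarrow> real) \<Rightarrow> ('x \<Rightarrow> 'z \<Rightarrow> 'y) \<Rightarrow> nat \<Rightarrow> (real ^ 'x) set" where
  "block_cols T Q h k = {((*v) (trans_mat T) ^^ j) (A_col Q h y) | j y. j < k \<and> y \<in> obs_space h}"

(* rank of (A TA ... T^(k-1) A) = dimension of its column space *)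
definition block_rank ::
  "('x::finite \<Rightarrow> 'x \<Rightarrow> real) \<Rightarrow> ('z::finite \<Rightarrow> real) \<Rightarrow> ('x \<Rightarrow> 'z \<Rightarrow> 'y) \<Rightarrow> nat \<Rightarrow> nat" where
  "block_rank T Q h k = dim (block_cols T Q h k)"

end

theory Submission
  imports Defs
begin

(* Summing the conditional law of (Y_1, ..., Y_N) given X_1 = x over all observation sequences
   with j-th entry y yields the column (T^j A)_y, by peeling off one time step at a time.
   Hence, if these columns span R^n, every f is an exact linear combination of the conditional
   laws. The rank statement is a Krylov space argument: the span of the first k + 1 blocks is
   determined by the span of the first k, so once it stops growing it stays constant, and it
   can grow at most n times. *)

lemma sum_lists_length_Suc:
  "(\<Sum>xs | length xs = Suc m \<and> hd xs \<in> A \<and> tl xs \<in> B. F xs)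
     = (\<Sum>x\<in>A. \<Sum>xs | length xs = m \<and> xs \<in> B. F (x # xs))"
proof -
  have set: "{xs. length xs = Suc m \<and> hd xs \<in> A \<and> tl xs \<in> B}
      = case_prod Cons ` (A \<times> {xs. length xs = m \<and> xs \<in> B})"
    by (auto simp: image_iff length_Suc_conv)
  have inj: "inj_on (case_prod Cons) (A \<times> {xs. length xs = m \<and> xs \<in> B})"
    by (auto simp: inj_on_def)
  show ?thesis
    unfolding set sum.reindex[OF inj] by (simp add: sum.cartesian_product comp_def split_def)
qed

definition noise_weight :: "('z::finite \<Rightarrow> real) \<Rightarrow> ('x \<Rightarrow> 'z \<Rightarrow> 'y) \<Rightarrow> 'x list \<Rightarrow> 'y list \<Rightarrow> real" where
  "noise_weight Q h xs ys =
     (\<Sum>zs | length zs = length ys \<and> (\<forall>i<length ys. h (xs ! i) (zs ! i) = ys ! i).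
        \<Prod>i<length ys. Q (zs ! i))"

lemma noise_weight_Nil [simp]: "noise_weight Q h xs [] = 1"
  by (simp add: noise_weight_def)

lemma noise_weight_Cons:
  "noise_weight Q h (x # xs) (y # ys) = A_col Q h y $ x * noise_weight Q h xs ys"
proof -
  let ?Z = "{zs. \<forall>i<length ys. h (xs ! i) (zs ! i) = ys ! i}"
  have "{zs. length zs = length (y # ys) \<and> (\<forall>i<length (y # ys). h ((x # xs) ! i) (zs ! i) = (y # ys) ! i)}
      = {zs. length zs = Suc (length ys) \<and> hd zs \<in> {z. h x z = y} \<and> tl zs \<in> ?Z}"
    by (auto simp: length_Suc_conv less_Suc_eq_0_disj)
  then have "noise_weight Q h (x # xs) (y # ys)
      = (\<Sum>z | h x z = y. \<Sum>zs | length zs = length ys \<and> zs \<in> ?Z. \<Prod>i<Suc (length ys). Q ((z # zs) ! i))"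
    by (simp only: noise_weight_def sum_lists_length_Suc length_Cons)
  also have "\<dots> = A_col Q h y $ x * noise_weight Q h xs ys"
    by (simp add: noise_weight_def A_col_def prod.lessThan_Suc_shift sum_product
        del: prod.lessThan_Suc)
  finally show ?thesis .
qed

definition path_weight :: "('x \<Rightarrow> 'x \<Rightarrow> real) \<Rightarrow> 'x list \<Rightarrow> real" where
  "path_weight T xs = (\<Prod>i<length xs - 1. T (xs ! i) (xs ! Suc i))"

lemma path_weight_singleton [simp]: "path_weight T [x] = 1"
  by (simp add: path_weight_def)

lemma path_weight_Cons_Cons: "path_weight T (x # x' # xs) = T x x' * path_weight T (x' # xs)"
  by (simp add: path_weight_def prod.lessThan_Suc_shift del: prod.lessThan_Suc)

lemma cond_law_Nil [simp]: "cond_law (T :: 'x::finite \<Rightarrow> 'x \<Rightarrow> real) Q h x [] = 1"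
  by (simp add: cond_law_def)

lemma cond_law_eq_sum_paths:
  "cond_law T Q h x ys = (\<Sum>xs | length xs = length ys \<and> (ys \<noteq> [] \<longrightarrow> hd xs = x).
      path_weight T xs * noise_weight Q h xs ys)"
  by (simp add: cond_law_def path_weight_def noise_weight_def sum_distrib_left)

lemma cond_law_Cons_eq_sum_paths:
  "cond_law T Q h x (y # ys)
     = (\<Sum>xs | length xs = length ys. path_weight T (x # xs) * noise_weight Q h (x # xs) (y # ys))"
proof -
  have "{xs. length xs = length (y # ys) \<and> (y # ys \<noteq> [] \<longrightarrow> hd xs = x)}
      = {xs. length xs = Suc (length ys) \<and> hd xs \<in> {x} \<and> tl xs \<in> UNIV}"
    by auto
  then show ?thesis
    by (simp only: cond_law_eq_sum_paths sum_lists_length_Suc) simp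
qed

lemma cond_law_Cons:
  fixes T :: "'x::finite \<Rightarrow> 'x \<Rightarrow> real"
  assumes "stochastic_matrix T"
  shows "cond_law T Q h x (y # ys) = A_col Q h y $ x * (\<Sum>x'\<in>UNIV. T x x' * cond_law T Q h x' ys)"
proof (cases ys)
  case Nil
  then show ?thesis
    using assms by (simp add: cond_law_Cons_eq_sum_paths noise_weight_Cons stochastic_matrix_def)
next
  case (Cons y' ys')
  have paths: "{xs. length xs = length ys}
      = {xs. length xs = Suc (length ys') \<and> hd xs \<in> UNIV \<and> tl xs \<in> UNIV}"
    using Cons by simp
  have "cond_law T Q h x (y # ys)
      = (\<Sum>x'\<in>UNIV. \<Sum>xs | length xs = length ys'.
           path_weight T (x # x' # xs) * noise_weight Q h (x # x' # xs) (y # ys))"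
    unfolding cond_law_Cons_eq_sum_paths paths sum_lists_length_Suc by simp
  also have "\<dots> = A_col Q h y $ x * (\<Sum>x'\<in>UNIV. T x x' * cond_law T Q h x' ys)"
    by (simp add: Cons cond_law_Cons_eq_sum_paths path_weight_Cons_Cons noise_weight_Cons
        sum_distrib_left mult_ac)
  finally show ?thesis .
qed

lemma finite_obs_space: "finite (obs_space (h :: 'x::finite \<Rightarrow> 'z::finite \<Rightarrow> 'y))"
proof -
  have "obs_space h = case_prod h ` UNIV"
    by (auto simp: obs_space_def)
  then show ?thesis
    by simp
qed

lemma sum_A_col_obs_space:
  fixes h :: "'x::finite \<Rightarrow> 'z::finite \<Rightarrow> 'y"
  assumes "prob_vector Q"
  shows "(\<Sum>y\<in>obs_space h. A_col Q h y $ x) = 1"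
proof -
  have "(\<Sum>y\<in>obs_space h. sum Q {z\<in>UNIV. h x z = y}) = sum Q UNIV"
    by (rule sum.group) (use finite_obs_space[of h] in \<open>auto simp: obs_space_def\<close>)
  then show ?thesis
    using assms by (simp add: A_col_def prob_vector_def)
qed

lemma sum_cond_law_Cons:
  fixes T :: "'x::finite \<Rightarrow> 'x \<Rightarrow> real" and Q :: "'z::finite \<Rightarrow> real"
  assumes "stochastic_matrix T" and "Y \<subseteq> obs_space h"
  shows "(\<Sum>ys | length ys = Suc m \<and> set ys \<subseteq> obs_space h \<and> hd ys \<in> Y \<and> tl ys \<in> B. cond_law T Q h x ys)
     = (\<Sum>y\<in>Y. A_col Q h y $ x)
       * (\<Sum>x'\<in>UNIV. T x x' * (\<Sum>ys | length ys = m \<and> set ys \<subseteq> obs_space h \<and> ys \<in> B. cond_law T Q h x' ys))"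
proof -
  have lists: "{ys. length ys = Suc m \<and> set ys \<subseteq> obs_space h \<and> hd ys \<in> Y \<and> tl ys \<in> B}
      = {ys. length ys = Suc m \<and> hd ys \<in> Y \<and> tl ys \<in> {ys. set ys \<subseteq> obs_space h \<and> ys \<in> B}}"
    using assms(2) by (auto simp: length_Suc_conv)
  let ?L = "{ys. length ys = m \<and> set ys \<subseteq> obs_space h \<and> ys \<in> B}"
  have "(\<Sum>ys\<in>?L. \<Sum>x'\<in>UNIV. T x x' * cond_law T Q h x' ys)
      = (\<Sum>x'\<in>UNIV. T x x' * (\<Sum>ys\<in>?L. cond_law T Q h x' ys))"
    by (simp add: sum.swap[of _ ?L] sum_distrib_left)
  then show ?thesis
    unfolding lists sum_lists_length_Suc
    by (simp add: cond_law_Cons[OF assms(1)] sum_distrib_right flip: sum_distrib_left)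
qed

lemma sum_cond_law_eq_1:
  fixes T :: "'x::finite \<Rightarrow> 'x \<Rightarrow> real" and Q :: "'z::finite \<Rightarrow> real"
  assumes "stochastic_matrix T" and "prob_vector Q"
  shows "(\<Sum>ys | length ys = m \<and> set ys \<subseteq> obs_space h. cond_law T Q h x ys) = 1"
proof (induction m arbitrary: x)
  case 0
  have "{ys. length ys = 0 \<and> set ys \<subseteq> obs_space h} = {[]}"
    by auto
  then show ?case
    by simp
next
  case (Suc m)
  have lists: "{ys. length ys = Suc m \<and> set ys \<subseteq> obs_space h}
      = {ys. length ys = Suc m \<and> set ys \<subseteq> obs_space h \<and> hd ys \<in> obs_space h \<and> tl ys \<in> UNIV}"
    by (auto simp: length_Suc_conv)
  show ?case
    unfolding lists sum_cond_law_Cons[OF assms(1) order_refl]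
    using assms by (simp add: Suc.IH sum_A_col_obs_space stochastic_matrix_def)
qed

lemma sum_cond_law_nth:
  fixes T :: "'x::finite \<Rightarrow> 'x \<Rightarrow> real" and Q :: "'z::finite \<Rightarrow> real"
  assumes "stochastic_matrix T" and "prob_vector Q" and "y \<in> obs_space h" and "j < N"
  shows "(\<Sum>ys | length ys = N \<and> set ys \<subseteq> obs_space h \<and> ys ! j = y. cond_law T Q h x ys)
     = (((*v) (trans_mat T) ^^ j) (A_col Q h y)) $ x"
  using \<open>j < N\<close>
proof (induction j arbitrary: N x)
  case 0
  then obtain m where N: "N = Suc m"
    by (cases N) auto
  have lists: "{ys. length ys = N \<and> set ys \<subseteq> obs_space h \<and> ys ! 0 = y}
      = {ys. length ys = Suc m \<and> set ys \<subseteq> obs_space h \<and> hd ys \<in> {y} \<and> tl ys \<in> UNIV}"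
    by (auto simp: N length_Suc_conv hd_conv_nth)
  have "{y} \<subseteq> obs_space h"
    using assms(3) by simp
  show ?case
    unfolding lists sum_cond_law_Cons[OF assms(1) \<open>{y} \<subseteq> obs_space h\<close>] using assms
    by (simp add: sum_cond_law_eq_1 stochastic_matrix_def)
next
  case (Suc j)
  then obtain m where N: "N = Suc m" and "j < m"
    by (cases N) auto
  have lists: "{ys. length ys = N \<and> set ys \<subseteq> obs_space h \<and> ys ! Suc j = y}
      = {ys. length ys = Suc m \<and> set ys \<subseteq> obs_space h \<and> hd ys \<in> obs_space h \<and> tl ys \<in> {ys. ys ! j = y}}"
    by (auto simp: N length_Suc_conv)
  show ?case
    unfolding lists sum_cond_law_Cons[OF assms(1) order_refl] using assms \<open>j < m\<close>
    by (simp add: Suc.IH sum_A_col_obs_space matrix_vector_mult_def trans_mat_def)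
qed

lemma span_image_eq_range_sum:
  fixes v :: "'i \<Rightarrow> 'a::real_vector"
  assumes "finite I"
  shows "span (v ` I) = range (\<lambda>c. \<Sum>i\<in>I. c i *\<^sub>R v i)"
proof
  show "span (v ` I) \<subseteq> range (\<lambda>c. \<Sum>i\<in>I. c i *\<^sub>R v i)"
  proof
    fix u assume "u \<in> span (v ` I)"
    then show "u \<in> range (\<lambda>c. \<Sum>i\<in>I. c i *\<^sub>R v i)"
    proof (induction rule: span_induct_alt)
      case base
      show ?case
        by (rule range_eqI[where x = "\<lambda>_. 0"]) simp
    next
      case (step a w u)
      then obtain i0 c where "i0 \<in> I" and w: "w = v i0" and u: "u = (\<Sum>i\<in>I. c i *\<^sub>R v i)"
        by blast
      have "(\<Sum>i\<in>I. (if i = i0 then a else 0) *\<^sub>R v i) = (\<Sum>i\<in>I. if i = i0 then a *\<^sub>R v i0 else 0)"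
        by (rule sum.cong) auto
      then have "a *\<^sub>R w + u = (\<Sum>i\<in>I. (c i + (if i = i0 then a else 0)) *\<^sub>R v i)"
        using u w \<open>i0 \<in> I\<close> assms by (simp add: scaleR_add_left sum.distrib)
      then show ?case
        by (rule range_eqI[where x = "\<lambda>i. c i + (if i = i0 then a else 0)"])
    qed
  qed
qed (auto intro: span_sum span_scale span_base)

lemma observable_if_span_block_cols_eq_UNIV:
  fixes T :: "'x::finite \<Rightarrow> 'x \<Rightarrow> real" and Q :: "'z::finite \<Rightarrow> real"
  assumes "stochastic_matrix T" and "prob_vector Q" and "span (block_cols T Q h N) = UNIV"
  shows "observable T Q h N"
  unfolding observable_def
proof (intro allI impI)
  fix f :: "'x \<Rightarrow> real" and \<epsilon> :: real
  assume "\<epsilon> > 0"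
  let ?L = "{ys. length ys = N \<and> set ys \<subseteq> obs_space h}"
  let ?law = "\<lambda>ys. \<chi> x. cond_law T Q h x ys"
  have "finite ?L"
    using finite_lists_length_eq[OF finite_obs_space[of h]] by (simp add: conj_commute)
  have "block_cols T Q h N \<subseteq> span (?law ` ?L)"
  proof
    fix v assume "v \<in> block_cols T Q h N"
    then obtain j y where v: "v = ((*v) (trans_mat T) ^^ j) (A_col Q h y)"
      and "j < N" and "y \<in> obs_space h"
      unfolding block_cols_def by blast
    then have "v = (\<Sum>ys\<in>{ys \<in> ?L. ys ! j = y}. ?law ys)"
      using sum_cond_law_nth[OF assms(1,2) \<open>y \<in> obs_space h\<close> \<open>j < N\<close>]
      by (simp add: vec_eq_iff sum_component conj_assoc)
    also have "\<dots> \<in> span (?law ` ?L)"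
      by (rule span_sum) (auto intro: span_base)
    finally show "v \<in> span (?law ` ?L)" .
  qed
  then have "span (block_cols T Q h N) \<subseteq> span (?law ` ?L)"
    by (rule span_minimal) (rule subspace_span)
  then have "(\<chi> x. f x) \<in> range (\<lambda>c. \<Sum>ys\<in>?L. c ys *\<^sub>R ?law ys)"
    using assms(3) span_image_eq_range_sum[OF \<open>finite ?L\<close>, of ?law] by auto
  then obtain c where "(\<chi> x. f x) = (\<Sum>ys\<in>?L. c ys *\<^sub>R ?law ys)"
    by blast
  then have "f x = (\<Sum>ys\<in>?L. c ys * cond_law T Q h x ys)" for x
    by (simp add: vec_eq_iff sum_component)
  then show "\<exists>g. \<forall>x. \<bar>f x - (\<Sum>ys\<in>?L. g ys * cond_law T Q h x ys)\<bar> < \<epsilon>"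
    using \<open>\<epsilon> > 0\<close> by (intro exI[of _ c]) simp
qed

definition krylov_vectors :: "('a \<Rightarrow> 'a) \<Rightarrow> 'a set \<Rightarrow> nat \<Rightarrow> 'a set" where
  "krylov_vectors f S k = {(f ^^ j) v | j v. j < k \<and> v \<in> S}"

lemma krylov_vectors_Suc: "krylov_vectors f S (Suc k) = S \<union> f ` krylov_vectors f S k"
proof (rule set_eqI, rule iffI)
  fix u assume "u \<in> krylov_vectors f S (Suc k)"
  then obtain j v where "u = (f ^^ j) v" and "j < Suc k" and "v \<in> S"
    unfolding krylov_vectors_def by blast
  then show "u \<in> S \<union> f ` krylov_vectors f S k"
    by (cases j) (auto simp: krylov_vectors_def)
next
  fix u assume "u \<in> S \<union> f ` krylov_vectors f S k"
  then consider "u \<in> S" | j v where "u = f ((f ^^ j) v)" and "j < k" and "v \<in> S"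
    unfolding krylov_vectors_def by blast
  then show "u \<in> krylov_vectors f S (Suc k)"
  proof cases
    case 1
    then have "u = (f ^^ 0) u \<and> 0 < Suc k \<and> u \<in> S"
      by simp
    then show ?thesis
      unfolding krylov_vectors_def by blast
  next
    case 2
    then have "u = (f ^^ Suc j) v \<and> Suc j < Suc k \<and> v \<in> S"
      by simp
    then show ?thesis
      unfolding krylov_vectors_def by blast
  qed
qed

lemma krylov_vectors_mono: "k \<le> l \<Longrightarrow> krylov_vectors f S k \<subseteq> krylov_vectors f S l"
  unfolding krylov_vectors_def by fastforce

lemma span_krylov_vectors_Suc_cong:
  assumes "linear f" and "span (krylov_vectors f S k) = span (krylov_vectors f S l)"
  shows "span (krylov_vectors f S (Suc k)) = span (krylov_vectors f S (Suc l))"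
  unfolding krylov_vectors_Suc span_Un span_linear_image[OF assms(1)] assms(2) ..

lemma span_krylov_vectors_stable:
  assumes "linear f" and "span (krylov_vectors f S s) = span (krylov_vectors f S (Suc s))"
  shows "span (krylov_vectors f S (s + i)) = span (krylov_vectors f S s)"
proof (induction i)
  case (Suc i)
  then have "span (krylov_vectors f S (Suc (s + i))) = span (krylov_vectors f S (Suc s))"
    by (rule span_krylov_vectors_Suc_cong[OF assms(1)])
  then show ?case
    using assms(2) by simp
qed simp

lemma dim_krylov_vectors_ge:
  fixes f :: "'a::euclidean_space \<Rightarrow> 'a"
  assumes "\<forall>s<t. span (krylov_vectors f S s) \<noteq> span (krylov_vectors f S (Suc s))"
  shows "t \<le> dim (krylov_vectors f S t)"
  using assms
proof (induction t)
  case (Suc t)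
  have "span (krylov_vectors f S t) \<subseteq> span (krylov_vectors f S (Suc t))"
    by (rule span_mono) (rule krylov_vectors_mono, simp)
  then have "span (krylov_vectors f S t) \<subset> span (krylov_vectors f S (Suc t))"
    using Suc.prems by auto
  then have "dim (krylov_vectors f S t) < dim (krylov_vectors f S (Suc t))"
    by (rule dim_psubset)
  then show ?case
    using Suc by simp
qed simp

lemma span_krylov_vectors_eq:
  fixes f :: "'a::euclidean_space \<Rightarrow> 'a"
  assumes "linear f" and "DIM('a) \<le> k"
  shows "span (krylov_vectors f S k) = span (krylov_vectors f S DIM('a))"
proof -
  obtain s where "s \<le> DIM('a)" and stable: "span (krylov_vectors f S s) = span (krylov_vectors f S (Suc s))"
    using dim_krylov_vectors_ge[of "Suc DIM('a)" f S] dim_subset_UNIV[of "krylov_vectors f S (Suc DIM('a))"]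
    by (auto simp: less_Suc_eq_le)
  have "span (krylov_vectors f S k) = span (krylov_vectors f S s)"
    using span_krylov_vectors_stable[OF assms(1) stable, of "k - s"] \<open>s \<le> DIM('a)\<close> assms(2) by simp
  also have "\<dots> = span (krylov_vectors f S DIM('a))"
    using span_krylov_vectors_stable[OF assms(1) stable, of "DIM('a) - s"] \<open>s \<le> DIM('a)\<close> by simp
  finally show ?thesis .
qed

lemma block_cols_eq_krylov_vectors:
  "block_cols T Q h k = krylov_vectors ((*v) (trans_mat T)) (A_col Q h ` obs_space h) k"
  unfolding block_cols_def krylov_vectors_def by blast

lemma block_rank_eq_of_CARD_le:
  fixes T :: "'x::finite \<Rightarrow> 'x \<Rightarrow> real"
  assumes "CARD('x) \<le> k"
  shows "block_rank T Q h k = block_rank T Q h CARD('x)"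
  using span_krylov_vectors_eq[OF matrix_vector_mul_linear[of "trans_mat T"], where k = k] assms
  unfolding block_rank_def block_cols_eq_krylov_vectors
  by (metis DIM_cart DIM_real dim_span mult_1_right)

theorem lemma1:
  fixes T :: "'x::finite \<Rightarrow> 'x \<Rightarrow> real" and Q :: "'z::finite \<Rightarrow> real"
    and h :: "'x \<Rightarrow> 'z \<Rightarrow> 'y"
  assumes "stochastic_matrix T" and "prob_vector Q"
  shows "(block_rank T Q h CARD('x) = CARD('x) \<longrightarrow> observable T Q h CARD('x))
       \<and> (block_rank T Q h CARD('x) \<noteq> CARD('x) \<longrightarrow>
            (\<forall>k\<ge>CARD('x). block_rank T Q h k = block_rank T Q h CARD('x)))"
proof (intro conjI impI allI)
  assume "block_rank T Q h CARD('x) = CARD('x)"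
  then have "span (block_cols T Q h CARD('x)) = UNIV"
    using dim_eq_full[of "block_cols T Q h CARD('x)"] by (simp add: block_rank_def)
  then show "observable T Q h CARD('x)"
    by (rule observable_if_span_block_cols_eq_UNIV[OF assms])
next
  fix k :: nat
  assume "CARD('x) \<le> k"
  then show "block_rank T Q h k = block_rank T Q h CARD('x)"
    by (rule block_rank_eq_of_CARD_le)
qed

end
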